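(* Let $(Q_\alpha)$ be a net of probability measures on $(\mathcal{F},\underline{\mathcal{B}}_F)$, let $Q$ be a probability measure on $(\mathcal{F},\underline{\mathcal{B}}_F)$, and let $D=D(E_0,Q)$ be the countable set of radii constructed in the context. Then the following two statements are equivalent: (1) $Q_\alpha \to_w Q$ on $(\mathcal{F},\tau_F)$. (2) $\lim_\alpha Q_\alpha(\mathcal{H}(U)) = Q(\mathcal{H}(U))$ for all $U \in \mathcal{U}(D)$.
   Context: $(E,\mathcal{G})$ is a locally compact second countable Hausdorff space, $\mathcal{F}$ the family of all closed subsets of $E$, $\mathcal{K}$ the family of all compact subsets. For $A\subseteq E$: $\mathcal{M}(A)=\{F\in\mathcal{F}: F\cap A=\emptyset\}$ and $\mathcal{H}(A)=\{F\in\mathcal{F}: F\cap A\neq\emptyset\}$. The Fell topology $\tau_F$ on $\mathcal{F}$ is the topology generated by $\{\mathcal{M}(K):K\in\mathcal{K}\}\cup\{\mathcal{H}(G):G\in\mathcal{G}\}$; $\underline{\mathcal{B}}_F=\sigma(\tau_F)$ is its Borel $\sigma$-algebra. Weak convergence $Q_\alpha\to_w Q$ on $(\mathcal{F},\tau_F)$ of a net of Borel probability measures means $\liminf_\alpha Q_\alpha(\mathbf{O})\ge Q(\mathbf{O})$ for all $\mathbf{O}\in\tau_F$. Fix a metric $d$ on $E$ inducing the topology $\mathcal{G}$ such that every $d$-bounded set is relatively compact (such $d$ exists by Vaughan's theorem), and a countable dense subset $E_0\subseteq E$. $\overline{B}(x,r)=\{y\in E: d(x,y)\le r\}$ for $x\in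 E$, $r\in\mathbb{R}$ (empty if $r<0$). For a set $D\subseteq\mathbb{R}$ put $$\mathcal{U}(D)=\Big\{\bigcup_{i=1}^m\overline{B}(x_i,r_i): m\in\mathbb{N},\ x_i\in E_0,\ r_i\in D,\ 1\le i\le m\Big\}.$$ A compact set $K\subseteq E$ is called a $Q$-continuity set if $Q(\partial_F\mathcal{H}(K))=0$, where $\partial_F$ is the boundary with respect to $\tau_F$; equivalently, $Q(\mathcal{H}(K))=Q(\mathcal{H}(K^0))$, with $K^0$ the interior of $K$. Construction of $D=D(E_0,Q)$: let $\mathbb{Q}_+$ be the set of positive rational numbers. For $x\in E_0$, $r\in\mathbb{Q}_+$ let $R_\pm(x,r)=\{s>0:\overline{B}(x,r\pm s)\text{ is a }Q\text{-continuity set}\}$ and $R=\bigcap_{x\in E_0,r\in\mathbb{Q}_+}R_+(x,r)\cap\bigcap_{x\in E_0,r\in\mathbb{Q}_+}R_-(x,r)$. The set $R$ has countable complement in $(0,\infty)$ and hence is dense in $[0,\infty)$. Fix a sequence $(s_k)_{k\in\mathbb{N}}$ in $R$ with $s_k\downarrow 0$ and put $D=\{r+s_k: r\in\mathbb{Q}_+,k\in\mathbb{N}\}\cup\{r-s_k: r\in\mathbb{Q}_+,k\in\mathbb{N}\}$. *)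

theory Defs
  imports "HOL-Probability.Probability"
begin

definition miss :: "'a topology \<Rightarrow> 'a set \<Rightarrow> 'a set set" where
  "miss X A = {F. closedin X F \<and> F \<inter> A = {}}"

definition hit :: "'a topology \<Rightarrow> 'a set \<Rightarrow> 'a set set" where
  "hit X A = {F. closedin X F \<and> F \<inter> A \<noteq> {}}"

definition fell :: "'a topology \<Rightarrow> 'a set topology" where
  "fell X = topology_generated_by
     ({miss X K |K. compactin X K} \<union> {hit X G |G. openin X G})"

lemma topspace_fell: "topspace (fell X) = {F. closedin X F}"
proof -
  have "miss X {} = {F. closedin X F}"
    by (simp add: miss_def)
  moreover have "compactin X {}"
    by simp
  ultimately have "{F. closedin X F} \<in> {miss X K |K. compactin X K}"
    by (metis (mono_tags, lifting) mem_Collect_eq)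
  then show ?thesis
    unfolding fell_def topology_generated_by_topspace
    by (auto simp: miss_def hit_def)
qed

definition fell_borel :: "'a topology \<Rightarrow> 'a set measure" where
  "fell_borel X = sigma (topspace (fell X)) {\<O>. openin (fell X) \<O>}"

lemma sets_fell_borel:
  "sets (fell_borel X) = sigma_sets {F. closedin X F} {\<O>. openin (fell X) \<O>}"
proof -
  have "{\<O>. openin (fell X) \<O>} \<subseteq> Pow (topspace (fell X))"
    by (auto dest: openin_subset)
  then show ?thesis
    by (simp add: fell_borel_def topspace_fell)
qed

definition fell_prob :: "'a topology \<Rightarrow> 'a set measure \<Rightarrow> bool" where
  "fell_prob X Q \<longleftrightarrow> prob_space Q \<and> sets Q = sets (fell_borel X)"

text \<open>A net is a family indexed by a directed set, i.e. a nonempty set \<open>A\<close> with a reflexive and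
  transitive (not necessarily antisymmetric) relation in which any two elements have an upper
  bound. Limits and lower limits of nets are those along the filter of tails of \<open>A\<close>.\<close>

definition directed_index :: "'i set \<Rightarrow> ('i \<Rightarrow> 'i \<Rightarrow> bool) \<Rightarrow> bool" where
  "directed_index A le \<longleftrightarrow> A \<noteq> {}
     \<and> (\<forall>a\<in>A. le a a)
     \<and> (\<forall>a\<in>A. \<forall>b\<in>A. \<forall>c\<in>A. le a b \<longrightarrow> le b c \<longrightarrow> le a c)
     \<and> (\<forall>a\<in>A. \<forall>b\<in>A. \<exists>c\<in>A. le a c \<and> le b c)"

definition net_filter :: "'i set \<Rightarrow> ('i \<Rightarrow> 'i \<Rightarrow> bool) \<Rightarrow> 'i filter" where
  "net_filter A le = (INF a\<in>A. principal {b \<in> A. le a b})"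

lemma eventually_net_filter:
  assumes "directed_index A le"
  shows "eventually P (net_filter A le) \<longleftrightarrow> (\<exists>a\<in>A. \<forall>b\<in>A. le a b \<longrightarrow> P b)"
proof -
  have "eventually P (net_filter A le) \<longleftrightarrow> (\<exists>a\<in>A. eventually P (principal {b \<in> A. le a b}))"
    unfolding net_filter_def
  proof (rule eventually_INF_base)
    show "A \<noteq> {}"
      using assms by (simp add: directed_index_def)
    fix a b assume ab: "a \<in> A" "b \<in> A"
    then obtain c where c: "c \<in> A" "le a c" "le b c"
      using assms unfolding directed_index_def by blast
    then have "{x \<in> A. le c x} \<subseteq> {x \<in> A. le a x} \<inter> {x \<in> A. le b x}"
      using assms ab unfolding directed_index_def by blast
    then show "\<exists>x\<in>A. principal {b \<in> A. le x b}
        \<le> inf (principal {b \<in> A. le a b}) (principal {x \<in> A. le b x})"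
      using c by auto
  qed
  then show ?thesis
    by (auto simp: eventually_principal)
qed

definition weakly_converges ::
  "'a topology \<Rightarrow> ('i \<Rightarrow> 'a set measure) \<Rightarrow> 'a set measure \<Rightarrow> 'i filter \<Rightarrow> bool" where
  "weakly_converges X Qs Q \<F> \<longleftrightarrow>
     (\<forall>\<O>. openin (fell X) \<O> \<longrightarrow>
        emeasure Q \<O> \<le> Liminf \<F> (\<lambda>\<alpha>. emeasure (Qs \<alpha>) \<O>))"

definition continuity_set :: "'a topology \<Rightarrow> 'a set measure \<Rightarrow> 'a set \<Rightarrow> bool" where
  "continuity_set X Q K \<longleftrightarrow>
     compactin X K \<and> emeasure Q (fell X frontier_of hit X K) = 0"

definition pos_rats :: "real set" where
  "pos_rats = {r \<in> \<rat>. 0 < r}"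

definition R_plus ::
  "'a topology \<Rightarrow> ('a \<Rightarrow> 'a \<Rightarrow> real) \<Rightarrow> 'a set measure \<Rightarrow> 'a \<Rightarrow> real \<Rightarrow> real set" where
  "R_plus X d Q x r =
     {s. 0 < s \<and> continuity_set X Q (Metric_space.mcball (topspace X) d x (r + s))}"

definition R_minus ::
  "'a topology \<Rightarrow> ('a \<Rightarrow> 'a \<Rightarrow> real) \<Rightarrow> 'a set measure \<Rightarrow> 'a \<Rightarrow> real \<Rightarrow> real set" where
  "R_minus X d Q x r =
     {s. 0 < s \<and> continuity_set X Q (Metric_space.mcball (topspace X) d x (r - s))}"

text \<open>The intersection with \<open>{0<..}\<close> matters only for empty \<open>E0\<close>: there the intersections
  over \<open>x \<in> E0\<close> are to be read inside \<open>{0<..}\<close>.\<close>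

definition R_set ::
  "'a topology \<Rightarrow> ('a \<Rightarrow> 'a \<Rightarrow> real) \<Rightarrow> 'a set \<Rightarrow> 'a set measure \<Rightarrow> real set" where
  "R_set X d E0 Q = {0<..}
     \<inter> (\<Inter>x\<in>E0. \<Inter>r\<in>pos_rats. R_plus X d Q x r)
     \<inter> (\<Inter>x\<in>E0. \<Inter>r\<in>pos_rats. R_minus X d Q x r)"

definition radii :: "(nat \<Rightarrow> real) \<Rightarrow> real set" where
  "radii s = {r + s k |r k. r \<in> pos_rats} \<union> {r - s k |r k. r \<in> pos_rats}"

definition ball_unions ::
  "'a topology \<Rightarrow> ('a \<Rightarrow> 'a \<Rightarrow> real) \<Rightarrow> 'a set \<Rightarrow> real set \<Rightarrow> 'a set set" where
  "ball_unions X d E0 D =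
     {(\<Union>i\<in>{1..m}. Metric_space.mcball (topspace X) d (x i) (r i)) |(m::nat) x r.
        1 \<le> m \<and> (\<forall>i\<in>{1..m}. x i \<in> E0 \<and> r i \<in> D)}"

end

theory Submission
  imports Defs
begin

text \<open>
  Missing sets turn unions into intersections, \<open>miss X U \<inter> miss X V = miss X (U \<union> V)\<close>, so the
  sets \<open>miss X U\<close>, where \<open>U\<close> runs through the finite unions of closed balls with centres in
  \<open>E0\<close> and admissible radii, form a countable family that is stable under intersection. Two
  facts about this family give the equivalence.

  From hitting probabilities to weak convergence: for a family stable under intersection,
  convergence of the probabilities of its members passes to all differences
  \<open>A - (B\<^sub>1 \<union> \<dots> \<union> B\<^sub>n)\<close> of members, since measures are additive; these differences are again
  stable under intersection, and so convergence passes to their finite unions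
  (\<open>tendsto_measure_Diff_Union\<close>, \<open>tendsto_measure_Union_diff_sets\<close>). The admissible radii are
  dense, so balls approximate compact sets from outside and open sets from inside, and the
  differences \<open>miss X U \<inter> hit X B\<^sub>1 \<inter> \<dots> \<inter> hit X B\<^sub>n\<close> refine the Fell topology at every
  point (\<open>fell_refined_by_ball_differences\<close>). There are only countably many of them. Hence
  the measure of a Fell-open set is the supremum of the measures of finite unions along which
  convergence holds, which is the required lower bound.

  From weak convergence to hitting probabilities: the usual portmanteau argument yields
  convergence on all sets with a null frontier. The radii are chosen such that \<open>hit X B\<close> has a
  null frontier for each ball \<open>B\<close>, and the frontier of a finite union is contained in the union
  of the frontiers.
\<close>

section \<open>Convergence of measures on families stable under intersection\<close>

definition diff_sets :: "'a set set \<Rightarrow> 'a set set" where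
  "diff_sets P = {S - \<Union>B |S B. S \<in> P \<and> finite B \<and> B \<subseteq> P}"

lemma subset_diff_sets: "P \<subseteq> diff_sets P"
proof
  fix S assume "S \<in> P"
  then have "S = S - \<Union>{} \<and> S \<in> P \<and> finite {} \<and> {} \<subseteq> P" by simp
  then show "S \<in> diff_sets P" unfolding diff_sets_def by blast
qed

lemma diff_sets_Int:
  assumes "\<And>S T. S \<in> P \<Longrightarrow> T \<in> P \<Longrightarrow> S \<inter> T \<in> P"
    and "V \<in> diff_sets P" "W \<in> diff_sets P"
  shows "V \<inter> W \<in> diff_sets P"
proof -
  obtain S B where V: "V = S - \<Union>B" "S \<in> P" "finite B" "B \<subseteq> P"
    using assms(2) unfolding diff_sets_def by blast
  obtain T C where W: "W = T - \<Union>C" "T \<in> P" "finite C" "C \<subseteq> P"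
    using assms(3) unfolding diff_sets_def by blast
  have "V \<inter> W = (S \<inter> T) - \<Union>(B \<union> C)"
    using V W by blast
  moreover have "S \<inter> T \<in> P" "finite (B \<union> C)" "B \<union> C \<subseteq> P"
    using V W assms(1) by auto
  ultimately show ?thesis
    unfolding diff_sets_def by blast
qed

lemma countable_diff_sets:
  assumes "countable P"
  shows "countable (diff_sets P)"
proof -
  have "diff_sets P = (\<lambda>(S, B). S - \<Union>B) ` (P \<times> {B. finite B \<and> B \<subseteq> P})"
    unfolding diff_sets_def by auto
  then show ?thesis
    using countable_Collect_finite_subset[OF assms] assms by (simp add: conj_commute)
qed

lemma diff_sets_subset_sets:
  assumes "P \<subseteq> sets M"
  shows "diff_sets P \<subseteq> sets M"
proof
  fix V assume "V \<in> diff_sets P"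
  then obtain S B where V: "V = S - \<Union>B" "S \<in> P" "finite B" "B \<subseteq> P"
    unfolding diff_sets_def by blast
  then have "\<Union>B \<in> sets M"
    using assms by (intro sets.finite_Union) auto
  then show "V \<in> sets M"
    using V assms by auto
qed

text \<open>Inclusion--exclusion, one set at a time: \<open>S - (b \<union> C)\<close> is \<open>S - C\<close> with its part
  \<open>(S \<inter> b) - C\<close> removed, and both are differences with fewer sets removed from a member of the
  family.\<close>

lemma tendsto_measure_Diff_Union:
  assumes fin: "\<forall>\<^sub>F \<alpha> in F. finite_measure (Qs \<alpha>) \<and> sets (Qs \<alpha>) = sets Q"
    and Q: "finite_measure Q"
    and Int: "\<And>S T. S \<in> P \<Longrightarrow> T \<in> P \<Longrightarrow> S \<inter> T \<in> P"
    and sets: "P \<subseteq> sets Q"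
    and conv: "\<And>S. S \<in> P \<Longrightarrow> ((\<lambda>\<alpha>. measure (Qs \<alpha>) S) \<longlongrightarrow> measure Q S) F"
    and B: "finite B" "B \<subseteq> P" and S: "S \<in> P"
  shows "((\<lambda>\<alpha>. measure (Qs \<alpha>) (S - \<Union>B)) \<longlongrightarrow> measure Q (S - \<Union>B)) F"
  using B S
proof (induction B arbitrary: S rule: finite_induct)
  case empty
  then show ?case using conv by simp
next
  case (insert b C)
  have C: "\<Union>C \<in> sets Q"
    using insert.hyps insert.prems sets by (intro sets.finite_Union) auto
  have diff: "measure M (S - \<Union>(insert b C)) = measure M (S - \<Union>C) - measure M ((S \<inter> b) - \<Union>C)"
    if "finite_measure M" "sets M = sets Q" for M
  proof -
    have "S - \<Union>(insert b C) = (S - \<Union>C) - ((S \<inter> b) - \<Union>C)"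
      by blast
    moreover have "S \<in> sets M" "b \<in> sets M" "\<Union>C \<in> sets M"
      using insert.prems sets C that by auto
    ultimately show ?thesis
      using finite_measure.finite_measure_Diff[OF that(1), of "S - \<Union>C" "(S \<inter> b) - \<Union>C"]
      by auto
  qed
  have "((\<lambda>\<alpha>. measure (Qs \<alpha>) (S - \<Union>C) - measure (Qs \<alpha>) ((S \<inter> b) - \<Union>C))
      \<longlongrightarrow> measure Q (S - \<Union>C) - measure Q ((S \<inter> b) - \<Union>C)) F"
    using insert Int by (intro tendsto_diff) auto
  moreover have "\<forall>\<^sub>F \<alpha> in F. measure (Qs \<alpha>) (S - \<Union>C) - measure (Qs \<alpha>) ((S \<inter> b) - \<Union>C)
      = measure (Qs \<alpha>) (S - \<Union>(insert b C))"
    using fin by eventually_elim (simp only: diff)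
  ultimately show ?case
    using diff[OF Q refl] by (simp only: tendsto_cong)
qed

text \<open>The same inclusion--exclusion step applies once more: relative to the whole space, a union
  is the complement of a difference, and the differences are stable under intersection.\<close>

lemma tendsto_measure_Union_diff_sets:
  assumes fin: "\<forall>\<^sub>F \<alpha> in F. finite_measure (Qs \<alpha>) \<and> sets (Qs \<alpha>) = sets Q"
    and Q: "finite_measure Q"
    and Int: "\<And>S T. S \<in> P \<Longrightarrow> T \<in> P \<Longrightarrow> S \<inter> T \<in> P"
    and sets: "P \<subseteq> sets Q" and space: "space Q \<in> P"
    and conv: "\<And>S. S \<in> P \<Longrightarrow> ((\<lambda>\<alpha>. measure (Qs \<alpha>) S) \<longlongrightarrow> measure Q S) F"
    and C: "finite C" "C \<subseteq> diff_sets P"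
  shows "((\<lambda>\<alpha>. measure (Qs \<alpha>) (\<Union>C)) \<longlongrightarrow> measure Q (\<Union>C)) F"
proof -
  note dsets = diff_sets_subset_sets[OF sets]
  have dconv: "((\<lambda>\<alpha>. measure (Qs \<alpha>) V) \<longlongrightarrow> measure Q V) F" if "V \<in> diff_sets P" for V
    using that tendsto_measure_Diff_Union[OF fin Q Int sets conv]
    unfolding diff_sets_def by blast
  have space': "space Q \<in> diff_sets P"
    using space subset_diff_sets by blast
  have C': "\<Union>C \<in> sets Q"
    using C dsets by (intro sets.finite_Union) auto
  have compl: "measure M (\<Union>C) = measure M (space Q) - measure M (space Q - \<Union>C)"
    if "finite_measure M" "sets M = sets Q" for M
    using finite_measure.finite_measure_compl[OF that(1), of "\<Union>C"] C' that
      sets_eq_imp_space_eq[OF that(2)] by auto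
  have "((\<lambda>\<alpha>. measure (Qs \<alpha>) (space Q) - measure (Qs \<alpha>) (space Q - \<Union>C))
      \<longlongrightarrow> measure Q (space Q) - measure Q (space Q - \<Union>C)) F"
    using tendsto_measure_Diff_Union[OF fin Q diff_sets_Int[OF Int] dsets dconv C space']
    by (intro tendsto_diff conv[OF space]) auto
  moreover have "\<forall>\<^sub>F \<alpha> in F. measure (Qs \<alpha>) (space Q) - measure (Qs \<alpha>) (space Q - \<Union>C)
      = measure (Qs \<alpha>) (\<Union>C)"
    using fin by eventually_elim (simp only: compl)
  ultimately show ?thesis
    using compl[OF Q refl] by (simp only: tendsto_cong)
qed

text \<open>A countable union is exhausted by finite unions up to a loss of measure that is smaller
  than any given amount; this is where countability of the family enters.\<close>

lemma eventually_measure_gt_of_refinement: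
  assumes fin: "\<forall>\<^sub>F \<alpha> in F. finite_measure (Qs \<alpha>) \<and> sets (Qs \<alpha>) = sets Q"
    and Q: "finite_measure Q"
    and Int: "\<And>S T. S \<in> P \<Longrightarrow> T \<in> P \<Longrightarrow> S \<inter> T \<in> P"
    and sets: "P \<subseteq> sets Q" and space: "space Q \<in> P" and P: "countable P"
    and conv: "\<And>S. S \<in> P \<Longrightarrow> ((\<lambda>\<alpha>. measure (Qs \<alpha>) S) \<longlongrightarrow> measure Q S) F"
    and refine: "\<And>x. x \<in> G \<Longrightarrow> \<exists>V\<in>diff_sets P. x \<in> V \<and> V \<subseteq> G"
    and a: "a < measure Q G"
  shows "\<forall>\<^sub>F \<alpha> in F. a < measure (Qs \<alpha>) G"
proof -
  interpret Q: finite_measure Q by fact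
  define \<V> where "\<V> = {V \<in> diff_sets P. V \<subseteq> G}"
  \<comment> \<open>The empty set is a difference, so the family is nonempty and can be enumerated even if
    \<open>G\<close> is empty.\<close>
  have "space Q - \<Union>{space Q} \<in> diff_sets P"
    unfolding diff_sets_def using space by blast
  then have ne: "\<V> \<noteq> {}"
    unfolding \<V>_def by auto
  have cV: "countable \<V>"
    unfolding \<V>_def using countable_diff_sets[OF P] by (rule countable_subset[rotated]) auto
  define V where "V = from_nat_into \<V>"
  have ran: "range V = \<V>"
    unfolding V_def using ne cV by (rule range_from_nat_into)
  have G: "G = (\<Union>n. V n)"
    using refine unfolding ran \<V>_def by blast
  have VQ: "V n \<in> sets Q" for n
    using ran diff_sets_subset_sets[OF sets] unfolding \<V>_def by blast
  define W where "W n = \<Union>(V ` {..n})" for n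
  have "(\<lambda>n. measure Q (W n)) \<longlonglongrightarrow> measure Q (\<Union>n. W n)"
    using VQ by (intro Q.finite_Lim_measure_incseq) (auto simp: W_def incseq_def intro: order_trans)
  moreover have "(\<Union>n. W n) = G"
    unfolding W_def G by auto
  ultimately have "\<forall>\<^sub>F n in sequentially. a < measure Q (W n)"
    using a order_tendstoD(1) by metis
  then obtain n where n: "a < measure Q (W n)"
    unfolding eventually_sequentially by blast
  have "V ` {..n} \<subseteq> diff_sets P"
    using ran unfolding \<V>_def by blast
  then have "((\<lambda>\<alpha>. measure (Qs \<alpha>) (W n)) \<longlongrightarrow> measure Q (W n)) F"
    unfolding W_def using tendsto_measure_Union_diff_sets[OF fin Q Int sets space conv] by blast
  then have "\<forall>\<^sub>F \<alpha> in F. a < measure (Qs \<alpha>) (W n)"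
    using n by (rule order_tendstoD(1))
  then show ?thesis
    using fin
  proof eventually_elim
    case (elim \<alpha>)
    have "G \<in> sets (Qs \<alpha>)"
      using elim VQ unfolding G by auto
    then have "measure (Qs \<alpha>) (W n) \<le> measure (Qs \<alpha>) G"
      using elim by (intro finite_measure.finite_measure_mono) (auto simp: W_def G)
    then show ?case using elim by simp
  qed
qed

section \<open>Weak convergence on the Fell hyperspace\<close>

lemma fell_open_in_sets:
  assumes "fell_prob X Q" "openin (fell X) G"
  shows "G \<in> sets Q"
  using assms by (simp add: fell_prob_def sets_fell_borel sigma_sets.Basic)

lemma fell_prob_space:
  assumes "fell_prob X Q"
  shows "space Q = topspace (fell X)"
proof -
  have "space Q = space (fell_borel X)"
    using assms by (intro sets_eq_imp_space_eq) (simp add: fell_prob_def)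
  also have "\<dots> = topspace (fell X)"
    unfolding fell_borel_def by (rule space_measure_of) (auto dest: openin_subset)
  finally show ?thesis .
qed

lemma fell_closed_in_sets:
  assumes "fell_prob X Q" "closedin (fell X) G"
  shows "G \<in> sets Q"
proof -
  have "topspace (fell X) - G \<in> sets Q"
    using assms by (intro fell_open_in_sets) auto
  then have "space Q - (space Q - G) \<in> sets Q"
    unfolding fell_prob_space[OF assms(1), symmetric] by auto
  moreover have "space Q - (space Q - G) = G"
    using closedin_subset[OF assms(2)] fell_prob_space[OF assms(1)] by auto
  ultimately show ?thesis by simp
qed

text \<open>The lower limit of the extended nonnegative values is traded for a condition on real
  numbers, in which differences of probabilities can be formed.\<close>

lemma weakly_converges_iff_measure:
  assumes ev: "\<forall>\<^sub>F \<alpha> in F. fell_prob X (Qs \<alpha>)" and Q: "fell_prob X Q"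
  shows "weakly_converges X Qs Q F \<longleftrightarrow>
    (\<forall>G. openin (fell X) G \<longrightarrow> (\<forall>a < measure Q G. \<forall>\<^sub>F \<alpha> in F. a < measure (Qs \<alpha>) G))"
proof -
  have em: "emeasure M G = ennreal (measure M G)" if "fell_prob X M" for M G
    using that unfolding fell_prob_def
    by (metis finite_measure.emeasure_eq_measure prob_space.finite_measure)
  have "emeasure Q G \<le> Liminf F (\<lambda>\<alpha>. emeasure (Qs \<alpha>) G) \<longleftrightarrow>
      (\<forall>a < measure Q G. \<forall>\<^sub>F \<alpha> in F. a < measure (Qs \<alpha>) G)" (is "?L \<longleftrightarrow> ?R") for G
  proof
    assume L: ?L
    show ?R
    proof (intro allI impI)
      fix a assume a: "a < measure Q G"
      show "\<forall>\<^sub>F \<alpha> in F. a < measure (Qs \<alpha>) G"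
      proof (cases "a < 0")
        case True
        then show ?thesis
          by (intro always_eventually allI less_le_trans[OF _ measure_nonneg])
      next
        case False
        then have "ennreal a < emeasure Q G"
          using a em[OF Q] by (simp add: ennreal_lessI)
        then have "\<forall>\<^sub>F \<alpha> in F. ennreal a < emeasure (Qs \<alpha>) G"
          using L by (simp add: le_Liminf_iff)
        then show ?thesis
          using ev
          by eventually_elim (use False in \<open>simp add: em ennreal_less_iff\<close>)
      qed
    qed
  next
    assume R: ?R
    show ?L
      unfolding le_Liminf_iff
    proof (intro allI impI)
      fix y assume y: "y < emeasure Q G"
      then have "y < top"
        using em[OF Q, of G] less_top_ennreal by (metis order_less_trans ennreal_less_top)
      then obtain a where a: "y = ennreal a" "0 \<le> a"
        by (cases y) auto
      then have "a < measure Q G"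
        using y em[OF Q] by (simp add: ennreal_less_iff)
      then have "\<forall>\<^sub>F \<alpha> in F. a < measure (Qs \<alpha>) G"
        using R by blast
      then show "\<forall>\<^sub>F \<alpha> in F. y < emeasure (Qs \<alpha>) G"
        using ev by eventually_elim (use a in \<open>simp add: em ennreal_less_iff\<close>)
    qed
  qed
  then show ?thesis
    unfolding weakly_converges_def by blast
qed

text \<open>The portmanteau argument: the interior of \<open>H\<close> has the full limit measure of \<open>H\<close>, so the
  lower bound for this open set bounds \<open>H\<close> from below; the lower bound for the complement of
  \<open>H\<close> bounds \<open>H\<close> from above.\<close>

lemma weakly_converges_imp_tendsto_measure:
  assumes ev: "\<forall>\<^sub>F \<alpha> in F. fell_prob X (Qs \<alpha>)" and Q: "fell_prob X Q"
    and weak: "weakly_converges X Qs Q F"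
    and H: "closedin (fell X) H" and null: "emeasure Q (fell X frontier_of H) = 0"
  shows "((\<lambda>\<alpha>. measure (Qs \<alpha>) H) \<longlongrightarrow> measure Q H) F"
proof (rule order_tendstoI)
  note lower = weak[unfolded weakly_converges_iff_measure[OF ev Q], rule_format]
  have prob: "prob_space M" if "fell_prob X M" for M
    using that by (simp add: fell_prob_def)
  let ?I = "fell X interior_of H"
  have "H = ?I \<union> (fell X frontier_of H)" and IH: "?I \<subseteq> H"
    using closedin_subset[OF H] H interior_of_subset[of "fell X" H]
    by (auto simp: frontier_of_def closure_of_closedin)
  then have eq: "measure Q H = measure Q ?I"
    using null fell_closed_in_sets[OF Q closedin_frontier_of]
      fell_open_in_sets[OF Q openin_interior_of]
    by (metis (no_types, lifting) measure_Un_null_set null_setsI)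
  fix a assume "a < measure Q H"
  then have "\<forall>\<^sub>F \<alpha> in F. a < measure (Qs \<alpha>) ?I"
    using lower[OF openin_interior_of, of a H] eq by simp
  then show "\<forall>\<^sub>F \<alpha> in F. a < measure (Qs \<alpha>) H"
    using ev
  proof eventually_elim
    case (elim \<alpha>)
    then show ?case
      using finite_measure.finite_measure_mono[OF prob_space.finite_measure[OF prob] IH]
        fell_closed_in_sets[OF _ H] by fastforce
  qed
next
  note lower = weak[unfolded weakly_converges_iff_measure[OF ev Q], rule_format]
  have compl: "measure M (topspace (fell X) - H) = 1 - measure M H" if "fell_prob X M" for M
    using prob_space.prob_compl[OF _ fell_closed_in_sets[OF that H]]
      fell_prob_space[OF that] that by (simp add: fell_prob_def)
  fix a assume "measure Q H < a"
  then have "1 - a < measure Q (topspace (fell X) - H)"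
    using compl[OF Q] by simp
  then have "\<forall>\<^sub>F \<alpha> in F. 1 - a < measure (Qs \<alpha>) (topspace (fell X) - H)"
    using H by (intro lower) auto
  then show "\<forall>\<^sub>F \<alpha> in F. measure (Qs \<alpha>) H < a"
    using ev by eventually_elim (simp add: compl)
qed

section \<open>Hit and miss sets of finite unions of balls\<close>

lemma miss_Int_miss: "miss X U \<inter> miss X V = miss X (U \<union> V)"
  by (auto simp: miss_def)

lemma hit_Union: "hit X (\<Union>\<U>) = \<Union>(hit X ` \<U>)"
  by (auto simp: hit_def)

lemma hit_eq_Diff_miss: "hit X U = topspace (fell X) - miss X U"
  by (auto simp: hit_def miss_def topspace_fell)

lemma miss_eq_Diff_hit: "miss X U = topspace (fell X) - hit X U"
  by (auto simp: hit_def miss_def topspace_fell)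

lemma openin_fell_miss: "compactin X K \<Longrightarrow> openin (fell X) (miss X K)"
  unfolding fell_def by (rule topology_generated_by_Basis) auto

lemma closedin_fell_hit: "compactin X K \<Longrightarrow> closedin (fell X) (hit X K)"
  unfolding hit_eq_Diff_miss by (intro closedin_diff openin_fell_miss closedin_topspace)

text \<open>A finite union of continuity sets is a continuity set because \<open>hit X\<close> commutes with
  unions and the frontier of a union lies in the union of the frontiers.\<close>

lemma continuity_set_Union:
  assumes Q: "fell_prob X Q" and fin: "finite \<U>"
    and cont: "\<And>U. U \<in> \<U> \<Longrightarrow> continuity_set X Q U"
  shows "continuity_set X Q (\<Union>\<U>)"
proof -
  have "compactin X (\<Union>\<U>)"
    using fin cont by (auto simp: continuity_set_def intro: compactin_Union)
  moreover have "fell X frontier_of (hit X U) \<in> null_sets Q" if "U \<in> \<U>" for U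
    using cont[OF that] fell_closed_in_sets[OF Q closedin_frontier_of]
    by (auto simp: continuity_set_def null_sets_def)
  then have "(\<Union>U\<in>\<U>. fell X frontier_of (hit X U)) \<in> null_sets Q"
    using fin by (intro null_sets.finite_UN) auto
  then have "fell X frontier_of (hit X (\<Union>\<U>)) \<in> null_sets Q"
  proof (rule null_sets_subset)
    show "fell X frontier_of (hit X (\<Union>\<U>)) \<in> sets Q"
      by (rule fell_closed_in_sets[OF Q closedin_frontier_of])
    show "fell X frontier_of (hit X (\<Union>\<U>)) \<subseteq> (\<Union>U\<in>\<U>. fell X frontier_of (hit X U))"
      using frontier_of_Union_subset[of "hit X ` \<U>" "fell X"] fin
      unfolding hit_Union by auto
  qed
  ultimately show ?thesis
    by (simp add: continuity_set_def null_sets_def)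
qed

lemma ball_unions_eq:
  "ball_unions X d E0 D = {\<Union>B |B. finite B \<and> B \<noteq> {} \<and>
     B \<subseteq> (\<lambda>(x, r). Metric_space.mcball (topspace X) d x r) ` (E0 \<times> D)}"
  (is "?L = ?R")
proof
  show "?L \<subseteq> ?R"
  proof
    fix U assume "U \<in> ?L"
    then obtain m x r where U: "U = (\<Union>i\<in>{1..m::nat}. Metric_space.mcball (topspace X) d (x i) (r i))"
      and m: "1 \<le> m" and xr: "\<forall>i\<in>{1..m}. x i \<in> E0 \<and> r i \<in> D"
      unfolding ball_unions_def by blast
    let ?B = "(\<lambda>i. Metric_space.mcball (topspace X) d (x i) (r i)) ` {1..m}"
    have "U = \<Union>?B" "finite ?B" "?B \<noteq> {}" using U m by auto
    moreover have "?B \<subseteq> (\<lambda>(x, r). Metric_space.mcball (topspace X) d x r) ` (E0 \<times> D)"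
      using xr by auto
    ultimately show "U \<in> ?R" by blast
  qed
  show "?R \<subseteq> ?L"
  proof
    fix U assume "U \<in> ?R"
    then obtain B where U: "U = \<Union>B" and B: "finite B" "B \<noteq> {}"
      "B \<subseteq> (\<lambda>(x, r). Metric_space.mcball (topspace X) d x r) ` (E0 \<times> D)" by blast
    obtain h where h: "bij_betw h {1..card B} B"
      using ex_bij_betw_nat_finite_1[OF B(1)] by blast
    have "\<forall>i\<in>{1..card B}. \<exists>x r. x \<in> E0 \<and> r \<in> D \<and> h i = Metric_space.mcball (topspace X) d x r"
      using B(3) bij_betwE[OF h] by fastforce
    then obtain x r where xr: "\<forall>i\<in>{1..card B}. x i \<in> E0 \<and> r i \<in> D
        \<and> h i = Metric_space.mcball (topspace X) d (x i) (r i)"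
      by metis
    have "U = (\<Union>i\<in>{1..card B}. h i)"
      unfolding U using bij_betw_imp_surj_on[OF h] by auto
    also have "\<dots> = (\<Union>i\<in>{1..card B}. Metric_space.mcball (topspace X) d (x i) (r i))"
      using xr by simp
    finally have "U = (\<Union>i\<in>{1..card B}. Metric_space.mcball (topspace X) d (x i) (r i))" .
    moreover have "1 \<le> card B"
      using B by (simp add: Suc_le_eq card_gt_0_iff)
    ultimately show "U \<in> ?L"
      unfolding ball_unions_def using xr by blast
  qed
qed

text \<open>The empty union is admitted here. It contributes the whole hyperspace \<open>miss X {}\<close>, whose
  probability is always one, also when there are no balls at all.\<close>

definition ball_misses ::
  "'a topology \<Rightarrow> ('a \<Rightarrow> 'a \<Rightarrow> real) \<Rightarrow> 'a set \<Rightarrow> real set \<Rightarrow> 'a set set set" where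
  "ball_misses X d E0 D = {miss X (\<Union>B) |B. finite B \<and>
     B \<subseteq> (\<lambda>(x, r). Metric_space.mcball (topspace X) d x r) ` (E0 \<times> D)}"

lemma ball_misses_eq: "ball_misses X d E0 D = miss X ` insert {} (ball_unions X d E0 D)"
proof -
  let ?N = "(\<lambda>(x, r). Metric_space.mcball (topspace X) d x r) ` (E0 \<times> D)"
  have "{B. finite B \<and> B \<subseteq> ?N} = insert {} {B. finite B \<and> B \<noteq> {} \<and> B \<subseteq> ?N}"
    by auto
  moreover have "ball_misses X d E0 D = miss X ` Union ` {B. finite B \<and> B \<subseteq> ?N}"
    unfolding ball_misses_def by blast
  moreover have "ball_unions X d E0 D = Union ` {B. finite B \<and> B \<noteq> {} \<and> B \<subseteq> ?N}"
    unfolding ball_unions_eq by blast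
  ultimately show ?thesis by simp
qed

lemma ball_misses_Int:
  assumes "S \<in> ball_misses X d E0 D" "T \<in> ball_misses X d E0 D"
  shows "S \<inter> T \<in> ball_misses X d E0 D"
proof -
  obtain B where B: "S = miss X (\<Union>B)" "finite B"
    "B \<subseteq> (\<lambda>(x, r). Metric_space.mcball (topspace X) d x r) ` (E0 \<times> D)"
    using assms(1) unfolding ball_misses_def by blast
  obtain C where C: "T = miss X (\<Union>C)" "finite C"
    "C \<subseteq> (\<lambda>(x, r). Metric_space.mcball (topspace X) d x r) ` (E0 \<times> D)"
    using assms(2) unfolding ball_misses_def by blast
  have "S \<inter> T = miss X (\<Union>(B \<union> C))" "finite (B \<union> C)"
    "B \<union> C \<subseteq> (\<lambda>(x, r). Metric_space.mcball (topspace X) d x r) ` (E0 \<times> D)"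
    using B C by (simp_all add: miss_Int_miss)
  then show ?thesis unfolding ball_misses_def by blast
qed

lemma countable_ball_misses:
  assumes "countable E0" "countable D"
  shows "countable (ball_misses X d E0 D)"
proof -
  let ?N = "(\<lambda>(x, r). Metric_space.mcball (topspace X) d x r) ` (E0 \<times> D)"
  have "countable {B. finite B \<and> B \<subseteq> ?N}"
    using assms by (intro countable_Collect_finite_subset) auto
  moreover have "ball_misses X d E0 D = (\<lambda>B. miss X (\<Union>B)) ` {B. finite B \<and> B \<subseteq> ?N}"
    unfolding ball_misses_def by blast
  ultimately show ?thesis by simp
qed

text \<open>If the ball of radius \<open>e\<close> around \<open>x\<close> lies in \<open>G\<close>, a centre at distance less than \<open>e/4\<close>
  from \<open>x\<close> and a radius strictly between \<open>e/4\<close> and \<open>e/2\<close> serve the purpose. The open ball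
  is recorded since finitely many of them must cover a compact set later.\<close>

lemma small_ball_around:
  assumes "Metric_space (topspace X) d" "Metric_space.mtopology (topspace X) d = X"
    and dense: "X closure_of E0 = topspace X"
    and D: "\<And>a b. 0 < a \<Longrightarrow> a < b \<Longrightarrow> \<exists>\<rho>\<in>D. a < \<rho> \<and> \<rho> < b"
    and G: "openin X G" "x \<in> G"
  shows "\<exists>y\<in>E0. \<exists>\<rho>\<in>D. x \<in> Metric_space.mball (topspace X) d y \<rho>
      \<and> Metric_space.mcball (topspace X) d y \<rho> \<subseteq> G"
proof -
  interpret Metric_space "topspace X" d by fact
  have x: "x \<in> topspace X" using G openin_subset by blast
  have "openin mtopology G" using G assms(2) by simp
  then obtain e where e: "e > 0" "mball x e \<subseteq> G"
    using G(2) by (meson openin_mtopology)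
  have "x \<in> mtopology closure_of E0" using x dense assms(2) by simp
  then have "\<forall>r>0. \<exists>y\<in>E0. y \<in> mball x r"
    unfolding metric_closure_of by blast
  then obtain y where y: "y \<in> E0" "y \<in> mball x (e/4)"
    using e(1) by (metis zero_less_divide_iff zero_less_numeral)
  obtain \<rho> where \<rho>: "\<rho> \<in> D" "e/4 < \<rho>" "\<rho> < e/2"
    using D[of "e/4" "e/2"] e(1) by auto
  have "mcball y \<rho> \<subseteq> mball x e"
  proof
    fix z assume z: "z \<in> mcball y \<rho>"
    then have "d x z \<le> d x y + d y z"
      using y x by (intro triangle) auto
    then show "z \<in> mball x e"
      using z y \<rho> x by auto
  qed
  moreover have "x \<in> mball y \<rho>"
    using y \<rho> x commute[of x y] by auto
  ultimately show ?thesis using y \<rho> e by blast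
qed

text \<open>It suffices to treat the subbasic sets, because the differences are stable under
  intersection. A compact set that misses a closed set \<open>F\<close> is
  covered by finitely many small balls that still miss \<open>F\<close>; a point of \<open>F\<close> in an open set has
  a small ball around it inside the open set.\<close>

lemma fell_refined_by_ball_differences:
  assumes metr: "Metric_space (topspace X) d" "Metric_space.mtopology (topspace X) d = X"
    and dense: "X closure_of E0 = topspace X"
    and D: "\<And>a b. 0 < a \<Longrightarrow> a < b \<Longrightarrow> \<exists>\<rho>\<in>D. a < \<rho> \<and> \<rho> < b"
    and G: "openin (fell X) G" and F: "F \<in> G"
  shows "\<exists>V\<in>diff_sets (ball_misses X d E0 D). F \<in> V \<and> V \<subseteq> G"
proof -
  interpret Metric_space "topspace X" d by fact
  have small: "\<exists>y\<in>E0. \<exists>\<rho>\<in>D. x \<in> mball y \<rho> \<and> mcball y \<rho> \<subseteq> H"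
    if "openin X H" "x \<in> H" for H x
    using small_ball_around[OF metr dense D that] .
  have "generate_topology_on ({miss X K |K. compactin X K} \<union> {hit X G |G. openin X G}) G"
    using G unfolding fell_def openin_topology_generated_by_iff .
  then show ?thesis
    using F
  proof (induction arbitrary: F)
    case Empty
    then show ?case by simp
  next
    case (Int a b)
    then obtain V W where "V \<in> diff_sets (ball_misses X d E0 D)" "F \<in> V" "V \<subseteq> a"
      "W \<in> diff_sets (ball_misses X d E0 D)" "F \<in> W" "W \<subseteq> b"
      by blast
    then show ?case
      using diff_sets_Int[OF ball_misses_Int] by (intro bexI[of _ "V \<inter> W"]) auto
  next
    case (UN \<G>)
    then show ?case by (metis UnionE Union_upper subset_trans)
  next
    case (Basis S)
    then consider K where "S = miss X K" "compactin X K" | H where "S = hit X H" "openin X H"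
      by blast
    then show ?case
    proof cases
      case 1
      have F: "closedin X F" "F \<inter> K = {}"
        using Basis(2) 1 by (auto simp: miss_def)
      define \<N> where "\<N> = {(y, \<rho>) \<in> E0 \<times> D. mcball y \<rho> \<inter> F = {}}"
      have cover: "K \<subseteq> \<Union>((\<lambda>(y, \<rho>). mball y \<rho>) ` \<N>)"
      proof
        fix x assume x: "x \<in> K"
        then have "x \<in> topspace X - F"
          using F compactin_subset_topspace[OF 1(2)] by auto
        then obtain y \<rho> where "y \<in> E0" "\<rho> \<in> D" "x \<in> mball y \<rho>" "mcball y \<rho> \<subseteq> topspace X - F"
          using small[of "topspace X - F" x] F by blast
        then show "x \<in> \<Union>((\<lambda>(y, \<rho>). mball y \<rho>) ` \<N>)"
          unfolding \<N>_def by blast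
      qed
      have opn: "openin X T" if "T \<in> (\<lambda>(y, \<rho>). mball y \<rho>) ` \<N>" for T
        using that openin_mball metr(2) by auto
      obtain \<T> where \<T>: "finite \<T>" "\<T> \<subseteq> (\<lambda>(y, \<rho>). mball y \<rho>) ` \<N>" "K \<subseteq> \<Union>\<T>"
        using compactinD[OF 1(2) opn cover] by blast
      obtain N where N: "N \<subseteq> \<N>" "finite N" "\<T> = (\<lambda>(y, \<rho>). mball y \<rho>) ` N"
        using finite_subset_image[OF \<T>(1,2)] by blast
      let ?B = "(\<lambda>(y, \<rho>). mcball y \<rho>) ` N"
      have "finite ?B" "?B \<subseteq> (\<lambda>(y, \<rho>). mcball y \<rho>) ` (E0 \<times> D)"
        using N by (auto simp: \<N>_def)
      then have "miss X (\<Union>?B) \<in> ball_misses X d E0 D"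
        unfolding ball_misses_def by blast
      moreover have "F \<in> miss X (\<Union>?B)"
        using F N by (auto simp: miss_def \<N>_def)
      moreover have "K \<subseteq> \<Union>?B"
      proof
        fix x assume "x \<in> K"
        then obtain y \<rho> where "(y, \<rho>) \<in> N" "x \<in> mball y \<rho>"
          using \<T>(3) N(3) by auto
        then show "x \<in> \<Union>?B"
          using mball_subset_mcball by blast
      qed
      then have "miss X (\<Union>?B) \<subseteq> S"
        unfolding 1 by (auto simp: miss_def)
      ultimately show ?thesis
        using subset_diff_sets by blast
    next
      case 2
      then obtain x where F: "closedin X F" "x \<in> F" "x \<in> H"
        using Basis(2) by (auto simp: hit_def)
      then obtain y \<rho> where y: "y \<in> E0" "\<rho> \<in> D" "x \<in> mball y \<rho>" "mcball y \<rho> \<subseteq> H"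
        using small[OF 2(2)] by blast
      have e: "miss X (\<Union>{}) \<in> ball_misses X d E0 D"
        unfolding ball_misses_def by blast
      have "finite {mcball y \<rho>}" "{mcball y \<rho>} \<subseteq> (\<lambda>(x, r). mcball x r) ` (E0 \<times> D)"
        using y by auto
      then have m: "miss X (\<Union>{mcball y \<rho>}) \<in> ball_misses X d E0 D"
        unfolding ball_misses_def by blast
      \<comment> \<open>Hit sets are differences as well: the whole hyperspace without one missing set.\<close>
      let ?V = "miss X (\<Union>{}) - \<Union>{miss X (\<Union>{mcball y \<rho>})}"
      have "?V \<in> diff_sets (ball_misses X d E0 D)"
        unfolding diff_sets_def using e m by blast
      moreover have V: "?V = hit X (mcball y \<rho>)"
        by (auto simp: hit_def miss_def)
      moreover have "x \<in> mcball y \<rho>"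
        using y mball_subset_mcball by blast
      then have "F \<in> hit X (mcball y \<rho>)"
        using F by (auto simp: hit_def)
      moreover have "hit X (mcball y \<rho>) \<subseteq> S"
        unfolding 2 using y(4) by (auto simp: hit_def)
      ultimately show ?thesis by metis
    qed
  qed
qed

section \<open>The set of admissible radii\<close>

lemma countable_radii: "countable (radii s)"
proof -
  have "countable pos_rats"
    unfolding pos_rats_def using countable_rat by (rule countable_subset[rotated]) auto
  moreover have "radii s = (\<lambda>(r, k). r + s k) ` (pos_rats \<times> UNIV) \<union> (\<lambda>(r, k). r - s k) ` (pos_rats \<times> UNIV)"
    unfolding radii_def by auto
  ultimately show ?thesis by simp
qed

lemma radii_dense:
  assumes pos: "\<And>k. 0 < s k" and lim: "s \<longlonglongrightarrow> 0" and ab: "0 < a" "a < b"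
  shows "\<exists>\<rho>\<in>radii s. a < \<rho> \<and> \<rho> < b"
proof -
  have "\<forall>\<^sub>F k in sequentially. s k < b - a"
    using lim ab by (intro order_tendstoD) auto
  then obtain k where k: "s k < b - a"
    unfolding eventually_sequentially by blast
  then obtain q where q: "q \<in> \<rat>" "a < q" "q < b - s k"
    using Rats_dense_in_real[of a "b - s k"] by auto
  have "q + s k \<in> radii s"
    unfolding radii_def pos_rats_def using q ab by auto
  then show ?thesis
    using q pos[of k] by (intro bexI[of _ "q + s k"]) auto
qed

lemma continuity_set_ball_unions:
  assumes Q: "fell_prob X Q" and s: "\<And>k. s k \<in> R_set X d E0 Q"
    and U: "U \<in> ball_unions X d E0 (radii s)"
  shows "continuity_set X Q U"
proof -
  obtain B where B: "U = \<Union>B" "finite B"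
    "B \<subseteq> (\<lambda>(x, r). Metric_space.mcball (topspace X) d x r) ` (E0 \<times> radii s)"
    using U unfolding ball_unions_eq by blast
  have "continuity_set X Q (Metric_space.mcball (topspace X) d x r)" if "x \<in> E0" "r \<in> radii s" for x r
    using that s unfolding radii_def R_set_def R_plus_def R_minus_def by blast
  then have "continuity_set X Q S" if "S \<in> B" for S
    using B that by auto
  then show ?thesis
    unfolding B(1) by (intro continuity_set_Union[OF Q B(2)])
qed


theorem theorem1:
  fixes X :: "'a topology" and d :: "'a \<Rightarrow> 'a \<Rightarrow> real" and E0 :: "'a set"
    and A :: "'i set" and le :: "'i \<Rightarrow> 'i \<Rightarrow> bool"
    and Qs :: "'i \<Rightarrow> 'a set measure" and Q :: "'a set measure"
    and s :: "nat \<Rightarrow> real"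
  assumes "locally_compact_space X" and "second_countable X" and "Hausdorff_space X"
    and "Metric_space (topspace X) d" and "Metric_space.mtopology (topspace X) d = X"
    and "\<And>S. Metric_space.mbounded (topspace X) d S \<Longrightarrow> compactin X (X closure_of S)"
    and "countable E0" and "E0 \<subseteq> topspace X" and "X closure_of E0 = topspace X"
    and "directed_index A le"
    and "\<And>\<alpha>. \<alpha> \<in> A \<Longrightarrow> fell_prob X (Qs \<alpha>)"
    and "fell_prob X Q"
    and "\<And>k. s k \<in> R_set X d E0 Q" and "decseq s" and "s \<longlonglongrightarrow> 0"
  shows "weakly_converges X Qs Q (net_filter A le) \<longleftrightarrow>
    (\<forall>U \<in> ball_unions X d E0 (radii s).
       ((\<lambda>\<alpha>. measure (Qs \<alpha>) (hit X U)) \<longlongrightarrow> measure Q (hit X U)) (net_filter A le))"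
proof -
  let ?F = "net_filter A le"
  have ev: "\<forall>\<^sub>F \<alpha> in ?F. fell_prob X (Qs \<alpha>)"
    using assms(10,11) unfolding eventually_net_filter[OF assms(10)] directed_index_def by blast
  note Q = assms(12)
  have fin: "\<forall>\<^sub>F \<alpha> in ?F. finite_measure (Qs \<alpha>) \<and> sets (Qs \<alpha>) = sets Q"
    using ev by eventually_elim (use Q in \<open>auto simp: fell_prob_def prob_space.finite_measure\<close>)
  have finQ: "finite_measure Q"
    using Q by (simp add: fell_prob_def prob_space.finite_measure)
  have cont: "continuity_set X Q U" if "U \<in> ball_unions X d E0 (radii s)" for U
    using continuity_set_ball_unions[OF Q assms(13) that] .
  have closed: "closedin (fell X) (hit X U)" if "U \<in> ball_unions X d E0 (radii s)" for U
    using cont[OF that] by (intro closedin_fell_hit) (simp add: continuity_set_def)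
  show ?thesis
  proof
    assume weak: "weakly_converges X Qs Q ?F"
    show "\<forall>U\<in>ball_unions X d E0 (radii s).
        ((\<lambda>\<alpha>. measure (Qs \<alpha>) (hit X U)) \<longlongrightarrow> measure Q (hit X U)) ?F"
      using weakly_converges_imp_tendsto_measure[OF ev Q weak closed] cont
      by (simp add: continuity_set_def)
  next
    assume hit: "\<forall>U\<in>ball_unions X d E0 (radii s).
        ((\<lambda>\<alpha>. measure (Qs \<alpha>) (hit X U)) \<longlongrightarrow> measure Q (hit X U)) ?F"
    let ?P = "ball_misses X d E0 (radii s)"
    have compl: "measure M (miss X U) = 1 - measure M (hit X U)"
      if "U \<in> insert {} (ball_unions X d E0 (radii s))" "fell_prob X M" for M U
    proof -
      have "closedin (fell X) (hit X U)"
        using that(1) closed by (auto simp: hit_def)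
      then show ?thesis
        using prob_space.prob_compl[OF _ fell_closed_in_sets[OF that(2)]] that(2)
        unfolding miss_eq_Diff_hit fell_prob_space[OF that(2), symmetric]
        by (simp add: fell_prob_def)
    qed
    have conv: "((\<lambda>\<alpha>. measure (Qs \<alpha>) S) \<longlongrightarrow> measure Q S) ?F" if "S \<in> ?P" for S
    proof -
      obtain U where U: "S = miss X U" "U \<in> insert {} (ball_unions X d E0 (radii s))"
        using \<open>S \<in> ?P\<close> unfolding ball_misses_eq by blast
      have "((\<lambda>\<alpha>. measure (Qs \<alpha>) (hit X U)) \<longlongrightarrow> measure Q (hit X U)) ?F"
        using U(2) hit by (auto simp: hit_def)
      then have "((\<lambda>\<alpha>. 1 - measure (Qs \<alpha>) (hit X U)) \<longlongrightarrow> 1 - measure Q (hit X U)) ?F"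
        by (intro tendsto_intros)
      moreover have "\<forall>\<^sub>F \<alpha> in ?F. 1 - measure (Qs \<alpha>) (hit X U) = measure (Qs \<alpha>) S"
        using ev by eventually_elim (simp add: U(1) compl[OF U(2)])
      ultimately show ?thesis
        using compl[OF U(2) Q] U(1) by (simp add: tendsto_cong)
    qed
    have sets: "?P \<subseteq> sets Q"
    proof
      fix S assume "S \<in> ?P"
      then obtain U where U: "S = miss X U" "U \<in> insert {} (ball_unions X d E0 (radii s))"
        unfolding ball_misses_eq by blast
      then have "compactin X U"
        using cont by (auto simp: continuity_set_def)
      then show "S \<in> sets Q"
        unfolding U(1) by (intro fell_open_in_sets[OF Q] openin_fell_miss)
    qed
    have space: "space Q \<in> ?P"
      unfolding ball_misses_eq fell_prob_space[OF Q] topspace_fell by (auto simp: miss_def)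
    have count: "countable ?P"
      by (rule countable_ball_misses[OF assms(7) countable_radii])
    have "0 < s k" for k
      using assms(13)[of k] by (simp add: R_set_def)
    note dense = radii_dense[OF this assms(15)]
    show "weakly_converges X Qs Q ?F"
      unfolding weakly_converges_iff_measure[OF ev Q]
      using eventually_measure_gt_of_refinement[OF fin finQ ball_misses_Int sets space count conv
          fell_refined_by_ball_differences[OF assms(4,5,9) dense]]
      by blast
  qed
qed

end
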